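(* Let the edges of the complete bipartite graph $K_{n,n}$ be coloured with red and blue. If there is a spanning bicoloured cycle that is not good, then there is a partition of $V(K_{n,n})$ into the vertex set of a red path and the vertex set of a blue cycle.
   Context: In a $2$-edge-coloured $K_{n,n}$, a (genuine, i.e. length at least $4$) cycle $C=v_1v_2\ldots v_kv_1$ (for a suitable labelling of its vertices in cyclic order) is called bicoloured if for some $\ell\in\{2,\ldots,k\}$ each edge $v_iv_{i+1}$ with $1\le i\le \ell-1$ has one colour, and all other edges of $C$ have the other colour. The vertices $v_1$ and $v_\ell$ are the turning points of $C$. (Monochromatic cycles are not bicoloured.) If $v_1$ and $v_\ell$ lie in distinct partition classes of $K_{n,n}$, the bicoloured cycle $C$ is called good. Spanning means containing all vertices. A red path (blue cycle) is one all of whose edges are red (blue). In the conclusion, a path may be empty or a single vertex, and the empty set, a single vertex, and a single edge also count as cycles; those without edges may be regarded as having either colour. *)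

theory Defs
  imports Main
begin

datatype colour = Red | Blue

text \<open>Edges are unordered pairs, represented as two-element sets; an edge colouring is a function
  on vertex sets, of which only the values at edges are ever used.\<close>

definition bipartite_edges :: "'a set \<Rightarrow> 'a set \<Rightarrow> 'a set set" where
  "bipartite_edges A B = {{a, b} | a b. a \<in> A \<and> b \<in> B}"

definition path_edge :: "'a list \<Rightarrow> nat \<Rightarrow> 'a set" where
  "path_edge vs i = {vs ! i, vs ! Suc i}"

definition cycle_edge :: "'a list \<Rightarrow> nat \<Rightarrow> 'a set" where
  "cycle_edge vs i = {vs ! i, vs ! (Suc i mod length vs)}"

definition cycle_edges :: "'a list \<Rightarrow> 'a set set" where
  "cycle_edges vs = cycle_edge vs ` {..<length vs}"

text \<open>A genuine cycle is the edge set \<open>C\<close> itself; the list \<open>vs\<close> is one of its labellings in cyclic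
  order (arbitrary starting vertex and orientation).\<close>

definition labels_cycle :: "'a set set \<Rightarrow> 'a list \<Rightarrow> 'a set set \<Rightarrow> bool" where
  "labels_cycle E vs C \<longleftrightarrow>
     distinct vs \<and> 4 \<le> length vs \<and> cycle_edges vs = C \<and> C \<subseteq> E"

text \<open>With \<open>v\<^sub>i = vs ! (i - 1)\<close>, \<open>k = length vs\<close> and \<open>\<ell> = Suc m\<close>, the range \<open>\<ell> \<in> {2..k}\<close> becomes
  \<open>1 \<le> m < k\<close>, and the turning points \<open>v\<^sub>1\<close>, \<open>v\<^sub>\<ell>\<close> are \<open>vs ! 0\<close> and \<open>vs ! m\<close>.\<close>

definition bicoloured_labelling ::
  "'a set set \<Rightarrow> ('a set \<Rightarrow> colour) \<Rightarrow> 'a list \<Rightarrow> nat \<Rightarrow> 'a set set \<Rightarrow> bool" where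
  "bicoloured_labelling E c vs m C \<longleftrightarrow>
     labels_cycle E vs C \<and> 1 \<le> m \<and> m < length vs \<and>
     (\<exists>col. (\<forall>i<m. c (cycle_edge vs i) = col) \<and>
            (\<forall>i. m \<le> i \<and> i < length vs \<longrightarrow> c (cycle_edge vs i) \<noteq> col))"

definition bicoloured_cycle :: "'a set set \<Rightarrow> ('a set \<Rightarrow> colour) \<Rightarrow> 'a set set \<Rightarrow> bool" where
  "bicoloured_cycle E c C \<longleftrightarrow> (\<exists>vs m. bicoloured_labelling E c vs m C)"

text \<open>The unordered pair of turning points does not depend on the labelling, so the existential
  quantifier below could equally be universal.\<close>

definition good_cycle ::
  "'a set \<Rightarrow> 'a set \<Rightarrow> ('a set \<Rightarrow> colour) \<Rightarrow> 'a set set \<Rightarrow> bool" where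
  "good_cycle A B c C \<longleftrightarrow>
     (\<exists>vs m. bicoloured_labelling (bipartite_edges A B) c vs m C \<and>
        (vs ! 0 \<in> A \<and> vs ! m \<in> B \<or> vs ! 0 \<in> B \<and> vs ! m \<in> A))"

text \<open>A path may be empty or a single vertex.\<close>

definition mono_path ::
  "'a set \<Rightarrow> 'a set set \<Rightarrow> ('a set \<Rightarrow> colour) \<Rightarrow> colour \<Rightarrow> 'a list \<Rightarrow> bool" where
  "mono_path V E c col vs \<longleftrightarrow>
     distinct vs \<and> set vs \<subseteq> V \<and>
     (\<forall>i. Suc i < length vs \<longrightarrow> path_edge vs i \<in> E \<and> c (path_edge vs i) = col)"

text \<open>Degenerate cycles are allowed here: the empty set and single vertices (of either colour), and
  single edges (\<open>length vs = 2\<close>, where both cyclic edges are the same edge). Length 3 is a triangle,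
  which a bipartite graph does not contain.\<close>

definition mono_cycle ::
  "'a set \<Rightarrow> 'a set set \<Rightarrow> ('a set \<Rightarrow> colour) \<Rightarrow> colour \<Rightarrow> 'a list \<Rightarrow> bool" where
  "mono_cycle V E c col vs \<longleftrightarrow>
     distinct vs \<and> set vs \<subseteq> V \<and>
     (2 \<le> length vs \<longrightarrow> (\<forall>e \<in> cycle_edges vs. e \<in> E \<and> c e = col))"

end

theory Submission imports Defs begin

text \<open>Let the turning points lie in the same class, so that the interior \<open>b\<^sub>1, \<dots>, b\<^sub>k\<close> of the blue
  part has odd length, and let the red part run from \<open>u\<close> to \<open>w\<close>, where \<open>w b\<^sub>1\<close> and \<open>b\<^sub>k u\<close> are
  blue. For \<open>k = 1\<close> the red part and the single vertex \<open>b\<^sub>1\<close> are as desired. Otherwise, by parity,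
  \<open>w b\<^sub>k\<close> and \<open>u b\<^sub>1\<close> are edges. If one of them is blue, it closes the blue path into a blue cycle
  through that one turning point, and the red path merely loses an endpoint. If both are red, they
  extend the red path to one from \<open>b\<^sub>k\<close> to \<open>b\<^sub>1\<close>, which gives a bicoloured cycle whose blue part is
  shorter by two vertices; iterate.\<close>

abbreviation col_adj :: "'a set set \<Rightarrow> ('a set \<Rightarrow> colour) \<Rightarrow> colour \<Rightarrow> 'a \<Rightarrow> 'a \<Rightarrow> bool" where
  "col_adj E c col x y \<equiv> {x, y} \<in> E \<and> c {x, y} = col"

lemma mono_path_iff_successively:
  "mono_path V E c col vs \<longleftrightarrow> distinct vs \<and> set vs \<subseteq> V \<and> successively (col_adj E c col) vs"
  by (auto simp: mono_path_def successively_conv_nth path_edge_def)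

text \<open>Only the last index wraps around in \<open>cycle_edge\<close>, and there it yields the
  closing edge. Cycles can thus be handled as walks with one extra edge, free of modular
  indices.\<close>

lemma mono_cycle_if_closed_path:
  assumes "distinct vs" "set vs \<subseteq> V" "successively (col_adj E c col) vs"
    "col_adj E c col (last vs) (hd vs)"
  shows "mono_cycle V E c col vs"
proof -
  have "col_adj E c col (vs ! i) (vs ! (Suc i mod length vs))" if "i < length vs" for i
  proof (cases "Suc i < length vs")
    case True
    then show ?thesis using assms(3) by (simp add: successively_conv_nth)
  next
    case False
    with that have "Suc i = length vs" by simp
    then have "vs \<noteq> []" "i = length vs - 1" "Suc i mod length vs = 0" by auto
    then have "vs ! i = last vs" "vs ! (Suc i mod length vs) = hd vs"
      by (simp_all add: last_conv_nth hd_conv_nth)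
    then show ?thesis using assms(4) by simp
  qed
  then show ?thesis
    using assms(1,2) by (auto simp: mono_cycle_def cycle_edges_def cycle_edge_def)
qed

lemma doubleton_in_bipartite_edges_iff:
  "{x, y} \<in> bipartite_edges A B \<longleftrightarrow> x \<in> A \<and> y \<in> B \<or> x \<in> B \<and> y \<in> A"
  by (auto simp: bipartite_edges_def doubleton_eq_iff)

text \<open>The two classes alternate along a walk, so parity of the number of vertices decides
  whether its ends lie in different classes.\<close>

lemma bipartite_walk_ends:
  assumes "A \<inter> B = {}" "successively (\<lambda>x y. {x, y} \<in> bipartite_edges A B) xs" "2 \<le> length xs"
  shows "{hd xs, last xs} \<in> bipartite_edges A B \<longleftrightarrow> even (length xs)"
proof -
  \<comment> \<open>Strengthened for the induction: non-adjacent ends are known to share a class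
    only once both lie in \<open>A \<union> B\<close>.\<close>
  have "hd xs \<in> A \<union> B \<and> last xs \<in> A \<union> B \<and>
      ({hd xs, last xs} \<in> bipartite_edges A B \<longleftrightarrow> even (length xs))"
    using assms(2,3)
  proof (induction xs rule: induct_list012)
    case (3 x y zs)
    show ?case
    proof (cases zs)
      case Nil
      with 3 show ?thesis by (auto simp: doubleton_in_bipartite_edges_iff)
    next
      case (Cons z zs')
      have "{x, y} \<in> bipartite_edges A B" using "3.prems" by simp
      moreover have "hd (y # zs) \<in> A \<union> B \<and> last (y # zs) \<in> A \<union> B \<and>
          ({hd (y # zs), last (y # zs)} \<in> bipartite_edges A B \<longleftrightarrow> even (length (y # zs)))"
        using "3.prems" Cons by (intro "3.IH"(2)) auto
      ultimately show ?thesis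
        using assms(1) by (auto simp: doubleton_in_bipartite_edges_iff)
    qed
  qed auto
  then show ?thesis by blast
qed

text \<open>The cycle is cut into \<open>rs\<close>, the red part with both turning points, and
  \<open>bs\<close>, the interior of the blue part. Odd length of \<open>bs\<close> expresses that
  the turning points share a class; it survives the iteration, which removes two vertices from
  \<open>bs\<close>.\<close>

lemma path_cycle_partition_of_bicoloured_cycle:
  assumes AB: "A \<inter> B = {}" and E: "E = bipartite_edges A B"
    and "distinct (rs @ bs)" "set (rs @ bs) = A \<union> B" "rs \<noteq> []" "odd (length bs)"
    and "successively (col_adj E c Red) rs"
    and "successively (col_adj E c Blue) (last rs # bs @ [hd rs])"
  shows "\<exists>P Q. mono_path (A \<union> B) E c Red P \<and> mono_cycle (A \<union> B) E c Blue Q \<and>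
    set P \<inter> set Q = {} \<and> set P \<union> set Q = A \<union> B"
  using assms(3-)
proof (induction "length bs" arbitrary: rs bs rule: less_induct)
  case less
  let ?r = "col_adj E c Red" and ?b = "col_adj E c Blue"
  note walk = \<open>successively ?b (last rs # bs @ [hd rs])\<close>
  have sub: "set rs \<subseteq> A \<union> B" "set bs \<subseteq> A \<union> B" using less.prems(2) by auto
  have dist: "distinct rs" "distinct bs" "set rs \<inter> set bs = {}" using less.prems(1) by auto
  show ?case
  proof (cases "\<exists>b. bs = [b]")
    case True
    then have "mono_cycle (A \<union> B) E c Blue bs"
      using sub by (auto simp: mono_cycle_def)
    moreover have "mono_path (A \<union> B) E c Red rs"
      using less.prems(5) sub dist by (simp add: mono_path_iff_successively)
    ultimately show ?thesis using dist less.prems(2) by (metis set_append)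
  next
    case False
    then obtain b1 bs' where "bs = b1 # bs'" "bs' \<noteq> []"
      using less.prems(4) by (cases bs) auto
    then obtain mid b2 where bs: "bs = b1 # mid @ [b2]"
      by (metis rev_exhaust)
    define u w where "u = hd rs" and "w = last rs"
    have w_walk: "successively ?b (w # bs)" and u_walk: "successively ?b (bs @ [u])"
      using walk successively_append_iff[of ?b "w # bs" "[u]"]
      by (auto simp: u_def w_def successively_Cons)
    have edges: "successively (\<lambda>x y. {x, y} \<in> E) xs" if "successively ?b xs" for xs
      using that by (rule successively_mono) auto
    \<comment> \<open>The walk \<open>w # bs\<close> has an even number of vertices, so its ends
      \<open>w\<close> and \<open>b2\<close> lie in different classes.\<close>
    have wE: "{w, b2} \<in> E"
      using bipartite_walk_ends[OF AB, of "w # bs"] edges[OF w_walk] less.prems(4)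
      by (simp add: E bs)
    have uE: "{u, b1} \<in> E"
      using bipartite_walk_ends[OF AB, of "bs @ [u]"] edges[OF u_walk] less.prems(4)
      by (simp add: E bs insert_commute)
    consider (w) "c {w, b2} = Blue" | (u) "c {u, b1} = Blue"
      | (red) "c {w, b2} = Red" "c {u, b1} = Red"
      by (metis colour.exhaust)
    then show ?thesis
    proof cases
      case w
      obtain rs' where rs: "rs = rs' @ [w]"
        using less.prems(3) unfolding w_def by (metis append_butlast_last_id)
      have "mono_cycle (A \<union> B) E c Blue (w # bs)"
        using w wE w_walk sub dist
        by (intro mono_cycle_if_closed_path) (auto simp: rs bs insert_commute)
      moreover have "mono_path (A \<union> B) E c Red rs'"
        using less.prems(5) sub dist
        by (auto simp: rs mono_path_iff_successively successively_append_iff)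
      moreover have "set rs' \<inter> set (w # bs) = {}" "set rs' \<union> set (w # bs) = A \<union> B"
        using dist less.prems(2) by (auto simp: rs)
      ultimately show ?thesis by blast
    next
      case u
      obtain rs' where rs: "rs = u # rs'"
        using less.prems(3) unfolding u_def by (metis list.collapse)
      have "mono_cycle (A \<union> B) E c Blue (bs @ [u])"
        using u uE u_walk sub dist
        by (intro mono_cycle_if_closed_path) (auto simp: rs bs insert_commute)
      moreover have "mono_path (A \<union> B) E c Red rs'"
        using less.prems(5) sub dist
        by (auto simp: rs mono_path_iff_successively successively_Cons)
      moreover have "set rs' \<inter> set (bs @ [u]) = {}" "set rs' \<union> set (bs @ [u]) = A \<union> B"
        using dist less.prems(2) by (auto simp: rs)
      ultimately show ?thesis by blast
    next
      case red
      \<comment> \<open>The new red edges attach \<open>b2\<close> to \<open>w = last rs\<close> and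
        \<open>b1\<close> to \<open>u = hd rs\<close>. With \<open>rs\<close> reversed, the longer
        red path runs from \<open>b2\<close> to \<open>b1\<close>, and the remaining blue walk
        \<open>b1 # mid @ [b2]\<close> leads from its last vertex back to its first, as the
        induction hypothesis requires.\<close>
      have "successively ?r (rev rs)"
        using less.prems(5) by (simp add: insert_commute)
      then have "successively ?r (b2 # rev rs @ [b1])"
        using red wE uE less.prems(3)
        by (auto simp: successively_Cons successively_append_iff hd_rev last_rev u_def w_def
            insert_commute)
      moreover have "successively ?b (b1 # mid @ [b2])"
        using w_walk by (simp add: bs)
      ultimately show ?thesis
        using less.prems(1,2,4)
        by (intro less.hyps[of mid "b2 # rev rs @ [b1]"]) (auto simp: bs)
    qed
  qed
qed

lemma cycle_edge_first_part:
  assumes "i < Suc (length p)"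
  shows "cycle_edge (x # p @ y # q) i = {(x # p @ [y]) ! i, (x # p @ [y]) ! Suc i}"
proof -
  let ?vs = "x # p @ y # q"
  have nth: "?vs ! k = (x # p @ [y]) ! k" if "k < length (x # p @ [y])" for k
    using that nth_append_left[of k "x # p @ [y]" q] by simp
  have "Suc i mod length ?vs = Suc i" using assms by simp
  then have "cycle_edge ?vs i = {?vs ! i, ?vs ! Suc i}" by (simp only: cycle_edge_def)
  also have "\<dots> = {(x # p @ [y]) ! i, (x # p @ [y]) ! Suc i}"
    using assms by (subst (1 2) nth) simp_all
  finally show ?thesis .
qed

lemma cycle_edge_second_part:
  assumes "j < Suc (length q)"
  shows "cycle_edge (x # p @ y # q) (Suc (length p) + j) =
    {(y # q @ [x]) ! j, (y # q @ [x]) ! Suc j}"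
proof -
  have nth: "(x # p @ y # q) ! (Suc (length p) + k) = (y # q @ [x]) ! k" if "k < Suc (length q)" for k
    using that nth_append_left[of k "y # q" "[x]"] by (simp add: nth_append)
  show ?thesis
  proof (cases "j = length q")
    \<comment> \<open>This is the last index of the cycle: its successor wraps to 0, so the edge
      returns to \<open>x\<close>.\<close>
    case True
    with nth[of j] show ?thesis by (simp add: cycle_edge_def)
  next
    case False
    with assms nth[of j] nth[of "Suc j"] show ?thesis
      by (simp add: cycle_edge_def)
  qed
qed

theorem corollary15:
  fixes A B :: "'a set" and n :: nat and c :: "'a set \<Rightarrow> colour"
  assumes "finite A" and "finite B" and "A \<inter> B = {}"
    and "card A = n" and "card B = n"
    and "\<exists>C. bicoloured_cycle (bipartite_edges A B) c C \<and> \<Union>C = A \<union> B \<and> \<not> good_cycle A B c C"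
  shows "\<exists>P Q. mono_path (A \<union> B) (bipartite_edges A B) c Red P \<and>
               mono_cycle (A \<union> B) (bipartite_edges A B) c Blue Q \<and>
               set P \<inter> set Q = {} \<and> set P \<union> set Q = A \<union> B"
proof -
  let ?E = "bipartite_edges A B"
  from assms(6) obtain C vs m where lab: "bicoloured_labelling ?E c vs m C"
    and C: "\<Union>C = A \<union> B" and bad: "\<not> good_cycle A B c C"
    by (auto simp: bicoloured_cycle_def)
  then obtain col where m: "1 \<le> m" "m < length vs"
    and dist: "distinct vs" and CE: "cycle_edges vs = C" "C \<subseteq> ?E"
    and col: "\<forall>i<m. c (cycle_edge vs i) = col"
      "\<forall>i. m \<le> i \<and> i < length vs \<longrightarrow> c (cycle_edge vs i) \<noteq> col"
    unfolding bicoloured_labelling_def labels_cycle_def by blast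
  \<comment> \<open>Here \<open>x\<close> and \<open>y\<close> are the turning points, and
    \<open>p\<close> and \<open>q\<close> are the interiors of the two arcs between them.\<close>
  obtain x p y q where vs: "vs = x # p @ y # q" and p: "m = Suc (length p)"
  proof -
    have "take m vs \<noteq> []" using m by auto
    then obtain x p where xp: "take m vs = x # p" by (cases "take m vs") auto
    with m have "m = Suc (length p)" using length_take[of m vs] by simp
    moreover have "vs = x # p @ vs ! m # drop (Suc m) vs"
      using id_take_nth_drop[OF m(2)] xp by simp
    ultimately show thesis using that by blast
  qed
  have inE: "cycle_edge vs i \<in> ?E" if "i < length vs" for i
    using that CE by (auto simp: cycle_edges_def)
  have "set vs = A \<union> B"
  proof -
    have "\<Union>(cycle_edges vs) = set vs"
    proof
      show "\<Union>(cycle_edges vs) \<subseteq> set vs"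
        using m by (auto simp: cycle_edges_def cycle_edge_def intro!: nth_mem mod_less_divisor)
      show "set vs \<subseteq> \<Union>(cycle_edges vs)"
        by (auto simp: cycle_edges_def cycle_edge_def in_set_conv_nth)
    qed
    then show ?thesis using C CE by simp
  qed
  have p_walk: "successively (col_adj ?E c col) (x # p @ [y])"
    unfolding successively_conv_nth
  proof (intro allI impI)
    fix i assume "Suc i < length (x # p @ [y])"
    then have "i < Suc (length p)" "i < length vs" using m p by auto
    then show "col_adj ?E c col ((x # p @ [y]) ! i) ((x # p @ [y]) ! Suc i)"
      using cycle_edge_first_part[of i p x y q, folded vs] inE[of i] col(1) by (metis p)
  qed
  \<comment> \<open>With only two colours, differing from \<open>col\<close> means having one fixed
    colour \<open>col'\<close>, so the second arc is monochromatic too.\<close>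
  obtain col' where col': "col' \<noteq> col" by (metis colour.distinct(1))
  then have col'_iff: "d \<noteq> col \<longleftrightarrow> d = col'" for d by (cases d; cases col; cases col') auto
  have q_walk: "successively (col_adj ?E c col') (y # q @ [x])"
    unfolding successively_conv_nth
  proof (intro allI impI)
    fix j assume "Suc j < length (y # q @ [x])"
    then have "j < Suc (length q)" "m + j < length vs" by (auto simp: vs p)
    moreover have "cycle_edge vs (m + j) = {(y # q @ [x]) ! j, (y # q @ [x]) ! Suc j}"
      unfolding vs p using \<open>j < Suc (length q)\<close> by (rule cycle_edge_second_part)
    moreover have "cycle_edge vs (m + j) \<in> ?E" "c (cycle_edge vs (m + j)) = col'"
      using inE[of "m + j"] col(2) \<open>m + j < length vs\<close> by (simp_all flip: col'_iff)
    ultimately show "col_adj ?E c col' ((y # q @ [x]) ! j) ((y # q @ [x]) ! Suc j)"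
      by (simp only:)
  qed
  have edges: "successively (\<lambda>x y. {x, y} \<in> ?E) xs" if "successively (col_adj ?E c d) xs" for xs d
    using that by (rule successively_mono) auto
  have "\<not> (vs ! 0 \<in> A \<and> vs ! m \<in> B \<or> vs ! 0 \<in> B \<and> vs ! m \<in> A)"
    using bad lab unfolding good_cycle_def by blast
  then have xy: "{x, y} \<notin> ?E"
    by (simp add: doubleton_in_bipartite_edges_iff vs p)
  \<comment> \<open>Both arcs join the non-adjacent vertices \<open>x\<close> and \<open>y\<close>,
    so each has an odd number of vertices, two of which are \<open>x\<close> and
    \<open>y\<close>.\<close>
  have odd: "odd (length p)" "odd (length q)"
    using bipartite_walk_ends[OF assms(3) edges[OF p_walk]]
      bipartite_walk_ends[OF assms(3) edges[OF q_walk]] xy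
    by (auto simp: insert_commute)
  \<comment> \<open>Whichever arc is red takes both turning points and becomes \<open>rs\<close>;
    the interior of the other becomes \<open>bs\<close>.\<close>
  show ?thesis
  proof (cases col)
    case Red
    with col' have "col' = Blue" by (cases col') auto
    then show ?thesis
      using p_walk q_walk Red odd dist \<open>set vs = A \<union> B\<close>
      by (intro path_cycle_partition_of_bicoloured_cycle[of A B ?E "x # p @ [y]" q])
        (auto simp: assms(3) vs)
  next
    case Blue
    with col' have "col' = Red" by (cases col') auto
    then show ?thesis
      using p_walk q_walk Blue odd dist \<open>set vs = A \<union> B\<close>
      by (intro path_cycle_partition_of_bicoloured_cycle[of A B ?E "y # q @ [x]" p])
        (auto simp: assms(3) vs)
  qed
qed

end
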